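(* Let $a_i,b_i\in\mathbb{R}^3$ and $\sigma_i>0$ for $i=1,\dots,N$, and let $\bar c^2$ be a given constant. Write $x=[q^{\mathsf T}\ q_1^{\mathsf T}\ \cdots\ q_N^{\mathsf T}]^{\mathsf T}\in\mathbb{R}^{4(N+1)}$. The optimization problem $$\min_{q\in S^3,\ q_i\in\{+q,-q\}}\ \sum_{i=1}^N \frac{\|\hat b_i-q\otimes\hat a_i\otimes q^{-1}+q^{\mathsf T}q_i\,\hat b_i-q\otimes\hat a_i\otimes q_i^{-1}\|^2}{4\sigma_i^2}+\frac{1-q^{\mathsf T}q_i}{2}\bar c^2$$ is equivalent, in the sense that they admit the same optimal solution $q$, to the Quadratically-Constrained Quadratic Program $$\min_{x\in\mathbb{R}^{4(N+1)}}\ \sum_{i=1}^N x^{\mathsf T}Q_ix\quad\text{subject to}\quad x_q^{\mathsf T}x_q=1,\qquad x_{q_i}x_{q_i}^{\mathsf T}=x_qx_q^{\mathsf T},\ \ i=1,\dots,N,$$ where $Q_i\in\mathbb{R}^{4(N+1)\times4(N+1)}$ are the symmetric matrices (depending only on the given data) specified in the context, and $x_q$ (resp. $x_{q_i}$) denotes the 4-dimensional subvector of $x$ corresponding to $q$ (resp. $q_i$).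
   Context: A quaternion is a column vector $q=[q_1\ q_2\ q_3\ q_4]^{\mathsf T}=[v^{\mathsf T}\ s]^{\mathsf T}\in\mathbb{R}^4$ with vector part $v\in\mathbb{R}^3$ and scalar part $s=q_4$. $S^3=\{q\in\mathbb{R}^4:\|q\|=1\}$. For $q\in\mathbb{R}^4$ define $$\Omega_1(q)=\begin{bmatrix} q_4&-q_3&q_2&q_1\\ q_3&q_4&-q_1&q_2\\ -q_2&q_1&q_4&q_3\\ -q_1&-q_2&-q_3&q_4\end{bmatrix},\qquad \Omega_2(q)=\begin{bmatrix} q_4&q_3&-q_2&q_1\\ -q_3&q_4&q_1&q_2\\ q_2&-q_1&q_4&q_3\\ -q_1&-q_2&-q_3&q_4\end{bmatrix}.$$ The quaternion product is $p\otimes q=\Omega_1(p)q=\Omega_2(q)p$. The inverse of a unit quaternion $q=[v^{\mathsf T}\ s]^{\mathsf T}$ is $q^{-1}=[-v^{\mathsf T}\ s]^{\mathsf T}$. For $a\in\mathbb{R}^3$, $\hat a=[a^{\mathsf T}\ 0]^{\mathsf T}\in\mathbb{R}^4$. In $q_i$ with $i$ indexing measurements, $q_i\in\mathbb{R}^4$ denotes a quaternion (not an entry). Matrices in $\mathbb{R}^{4(N+1)\times 4(N+1)}$ are partitioned into $4\times4$ blocks indexed by $(q,q_1,\dots,q_N)$. $Q_i$ has block $(q_i,q_i)$ equal to $Q_{ii}$, blocks $(q,q_i)$ and $(q_i,q)$ equal to $Q_{0i}$, and all other blocks zero, where $$Q_{ii}=\frac{(\|b_i\|^2+\|a_i\|^2)I_4+2\Omega_1(\hat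 b_i)\Omega_2(\hat a_i)}{2\sigma_i^2}+\frac{\bar c^2}{2}I_4,\qquad Q_{0i}=\frac{(\|b_i\|^2+\|a_i\|^2)I_4+2\Omega_1(\hat b_i)\Omega_2(\hat a_i)}{4\sigma_i^2}-\frac{\bar c^2}{4}I_4 .$$ "Same optimal solution $q$" means that $q$ is the $q$-component of a minimizer of one problem if and only if it is the $q$-component of a minimizer of the other. *)

theory Defs
  imports "HOL-Analysis.Analysis"
begin

text \<open>A quaternion is a vector in \<open>real^4\<close> whose scalar part is the \<^emph>\<open>last\<close> component.\<close>

definition Omega1 :: "real^4 \<Rightarrow> real^4^4" where
  "Omega1 q = vector
    [vector [  q$4, - q$3,   q$2, q$1],
     vector [  q$3,   q$4, - q$1, q$2],
     vector [- q$2,   q$1,   q$4, q$3],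
     vector [- q$1, - q$2, - q$3, q$4]]"

definition Omega2 :: "real^4 \<Rightarrow> real^4^4" where
  "Omega2 q = vector
    [vector [  q$4,   q$3, - q$2, q$1],
     vector [- q$3,   q$4,   q$1, q$2],
     vector [  q$2, - q$1,   q$4, q$3],
     vector [- q$1, - q$2, - q$3, q$4]]"

definition qmult :: "real^4 \<Rightarrow> real^4 \<Rightarrow> real^4"  (infixl "\<otimes>\<^sub>q" 70) where
  "p \<otimes>\<^sub>q q = Omega1 p *v q"

lemma vector_4_nth:
  "(vector [x, y, z, w] :: ('a::zero)^4) $ 1 = x"
  "(vector [x, y, z, w] :: ('a::zero)^4) $ 2 = y"
  "(vector [x, y, z, w] :: ('a::zero)^4) $ 3 = z"
  "(vector [x, y, z, w] :: ('a::zero)^4) $ 4 = w"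
  unfolding vector_def by simp_all

lemma qmult_Omega2: "p \<otimes>\<^sub>q q = Omega2 q *v p"
  by (simp add: qmult_def vec_eq_iff forall_4 matrix_vector_mult_def sum_4
      Omega1_def Omega2_def vector_4_nth algebra_simps)

text \<open>This is the inverse only for unit quaternions, the only case in which it is used.\<close>

definition qinv :: "real^4 \<Rightarrow> real^4" where
  "qinv q = vector [- q$1, - q$2, - q$3, q$4]"

definition qhat :: "real^3 \<Rightarrow> real^4" where
  "qhat a = vector [a$1, a$2, a$3, 0]"

text \<open>
  The \<open>N \<ge> 1\<close> measurements are indexed by a finite type \<open>'n\<close>. In the original problem the variables
  are \<open>q\<close> and the family \<open>qs\<close> of the \<open>q\<^sub>i\<close>.
\<close>

definition orig_feasible :: "(real^4) \<times> ('n \<Rightarrow> real^4) \<Rightarrow> bool" where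
  "orig_feasible = (\<lambda>(q, qs). q \<in> sphere 0 1 \<and> (\<forall>i. qs i \<in> {q, - q}))"

definition orig_cost ::
  "('n::finite \<Rightarrow> real^3) \<Rightarrow> ('n \<Rightarrow> real^3) \<Rightarrow> ('n \<Rightarrow> real) \<Rightarrow> real
    \<Rightarrow> (real^4) \<times> ('n \<Rightarrow> real^4) \<Rightarrow> real" where
  "orig_cost a b \<sigma> c = (\<lambda>(q, qs). \<Sum>i\<in>UNIV.
     (norm (qhat (b i) - q \<otimes>\<^sub>q qhat (a i) \<otimes>\<^sub>q qinv q
        + (q \<bullet> qs i) *\<^sub>R qhat (b i) - q \<otimes>\<^sub>q qhat (a i) \<otimes>\<^sub>q qinv (qs i)))\<^sup>2 / (4 * (\<sigma> i)\<^sup>2)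
     + (1 - q \<bullet> qs i) / 2 * c\<^sup>2)"

text \<open>
  Vectors of dimension \<open>4(N+1)\<close> are indexed by \<open>'n option \<times> 4\<close>: the first component names the
  4-dimensional block, \<open>None\<close> being the block of \<open>q\<close> and \<open>Some i\<close> the block of \<open>q\<^sub>i\<close>.
\<close>

definition subvec :: "real^('n::finite option \<times> 4) \<Rightarrow> 'n option \<Rightarrow> real^4" where
  "subvec x k = (\<chi> j. x $ (k, j))"

definition Q_diag :: "real^3 \<Rightarrow> real^3 \<Rightarrow> real \<Rightarrow> real \<Rightarrow> real^4^4" where
  "Q_diag a b s c =
     (1 / (2 * s\<^sup>2)) *\<^sub>R (((norm b)\<^sup>2 + (norm a)\<^sup>2) *\<^sub>R mat 1
        + 2 *\<^sub>R (Omega1 (qhat b) ** Omega2 (qhat a)))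
     + (c\<^sup>2 / 2) *\<^sub>R mat 1"

definition Q_off :: "real^3 \<Rightarrow> real^3 \<Rightarrow> real \<Rightarrow> real \<Rightarrow> real^4^4" where
  "Q_off a b s c =
     (1 / (4 * s\<^sup>2)) *\<^sub>R (((norm b)\<^sup>2 + (norm a)\<^sup>2) *\<^sub>R mat 1
        + 2 *\<^sub>R (Omega1 (qhat b) ** Omega2 (qhat a)))
     - (c\<^sup>2 / 4) *\<^sub>R mat 1"

definition Q_block ::
  "('n \<Rightarrow> real^3) \<Rightarrow> ('n \<Rightarrow> real^3) \<Rightarrow> ('n \<Rightarrow> real) \<Rightarrow> real
    \<Rightarrow> 'n \<Rightarrow> 'n option \<Rightarrow> 'n option \<Rightarrow> real^4^4" where
  "Q_block a b \<sigma> c i k l =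
     (if k = Some i \<and> l = Some i then Q_diag (a i) (b i) (\<sigma> i) c
      else if k = None \<and> l = Some i \<or> k = Some i \<and> l = None then Q_off (a i) (b i) (\<sigma> i) c
      else 0)"

definition Q_mat ::
  "('n::finite \<Rightarrow> real^3) \<Rightarrow> ('n \<Rightarrow> real^3) \<Rightarrow> ('n \<Rightarrow> real) \<Rightarrow> real
    \<Rightarrow> 'n \<Rightarrow> real^('n option \<times> 4)^('n option \<times> 4)" where
  "Q_mat a b \<sigma> c i = (\<chi> r s. Q_block a b \<sigma> c i (fst r) (fst s) $ snd r $ snd s)"

definition qcqp_cost ::
  "('n::finite \<Rightarrow> real^3) \<Rightarrow> ('n \<Rightarrow> real^3) \<Rightarrow> ('n \<Rightarrow> real) \<Rightarrow> real
    \<Rightarrow> real^('n option \<times> 4) \<Rightarrow> real" where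
  "qcqp_cost a b \<sigma> c x = (\<Sum>i\<in>UNIV. x \<bullet> (Q_mat a b \<sigma> c i *v x))"

definition outer :: "real^4 \<Rightarrow> real^4 \<Rightarrow> real^4^4" where
  "outer u v = (columnvector u :: real^1^4) ** rowvector v"

definition qcqp_feasible :: "real^('n::finite option \<times> 4) \<Rightarrow> bool" where
  "qcqp_feasible x \<longleftrightarrow> subvec x None \<bullet> subvec x None = 1 \<and>
     (\<forall>i. outer (subvec x (Some i)) (subvec x (Some i)) = outer (subvec x None) (subvec x None))"

end

theory Submission
  imports Defs
begin

text \<open>
  On either feasible set every \<open>q\<^sub>i\<close> equals \<open>\<plusminus>q\<close>: the rank-one equation \<open>u u\<^sup>T = v v\<^sup>T\<close>
  applied to \<open>v\<close> gives \<open>(u \<bullet> v) u = v\<close> when \<open>v\<close> is a unit vector. Moreover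
  \<open>\<parallel>b - q \<otimes> a \<otimes> q\<^sup>-\<^sup>1\<parallel>\<^sup>2\<close> is the quadratic form of
  \<open>M = (\<parallel>b\<parallel>\<^sup>2 + \<parallel>a\<parallel>\<^sup>2) I + 2 \<Omega>\<^sub>1(b) \<Omega>\<^sub>2(a)\<close> at a unit quaternion \<open>q\<close>, because right
  multiplication by \<open>q\<^sup>-\<^sup>1\<close> is adjoint to right multiplication by \<open>q\<close> and left multiplication by a
  pure quaternion is skew. With \<open>\<theta> = q \<bullet> q\<^sub>i = \<plusminus>1\<close> both costs of measurement \<open>i\<close> then equal
  \<open>(1 + \<theta>) q\<^sup>T M q / (2 \<sigma>\<^sup>2) + (1 - \<theta>) c\<^sup>2 / 2\<close>, so splitting \<open>x\<close> into its
  blocks identifies the two problems.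
\<close>

lemma inner_4: "(x::real^4) \<bullet> y = x$1 * y$1 + x$2 * y$2 + x$3 * y$3 + x$4 * y$4"
  by (simp add: inner_vec_def sum_4)

lemma qmult_nth:
  "(p \<otimes>\<^sub>q q) $ 1 = p$4 * q$1 - p$3 * q$2 + p$2 * q$3 + p$1 * q$4"
  "(p \<otimes>\<^sub>q q) $ 2 = p$3 * q$1 + p$4 * q$2 - p$1 * q$3 + p$2 * q$4"
  "(p \<otimes>\<^sub>q q) $ 3 = - p$2 * q$1 + p$1 * q$2 + p$4 * q$3 + p$3 * q$4"
  "(p \<otimes>\<^sub>q q) $ 4 = - p$1 * q$1 - p$2 * q$2 - p$3 * q$3 + p$4 * q$4"
  by (simp_all add: qmult_def matrix_vector_mult_def sum_4 Omega1_def vector_4_nth)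

text \<open>\<open>qinv\<close> is quaternion conjugation, and conjugating the right factor
  transposes right multiplication.\<close>

lemma inner_qmult_qinv: "p \<bullet> (r \<otimes>\<^sub>q qinv q) = (p \<otimes>\<^sub>q q) \<bullet> r"
  by (simp add: inner_4 qmult_nth qinv_def vector_4_nth algebra_simps)

lemma inner_qmult_qhat: "p \<bullet> (qhat b \<otimes>\<^sub>q r) = - ((qhat b \<otimes>\<^sub>q p) \<bullet> r)"
  by (simp add: inner_4 qmult_nth qhat_def vector_4_nth algebra_simps)

text \<open>Euler's four-square identity.\<close>

lemma inner_qmult_self: "(p \<otimes>\<^sub>q q) \<bullet> (p \<otimes>\<^sub>q q) = (p \<bullet> p) * (q \<bullet> q)"
  unfolding inner_4 qmult_nth by algebra

lemma inner_qinv_self: "qinv q \<bullet> qinv q = q \<bullet> q"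
  by (simp add: inner_4 qinv_def vector_4_nth)

lemma inner_qhat_self: "qhat a \<bullet> qhat a = (norm a)\<^sup>2"
  by (simp add: inner_4 qhat_def vector_4_nth power2_norm_eq_inner inner_vec_def sum_3)

lemma qinv_scaleR: "qinv (t *\<^sub>R q) = t *\<^sub>R qinv q"
  by (simp add: vec_eq_iff forall_4 qinv_def vector_4_nth)

lemma qmult_scaleR_right: "p \<otimes>\<^sub>q (t *\<^sub>R q) = t *\<^sub>R (p \<otimes>\<^sub>q q)"
  by (simp add: vec_eq_iff forall_4 qmult_nth algebra_simps)

text \<open>The matrix M of the overview; \<open>Q_diag\<close> and \<open>Q_off\<close> are both a
  scaling of it plus a multiple of the identity.\<close>

definition measurement_matrix :: "real^3 \<Rightarrow> real^3 \<Rightarrow> real^4^4" where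
  "measurement_matrix a b =
     ((norm b)\<^sup>2 + (norm a)\<^sup>2) *\<^sub>R mat 1 + 2 *\<^sub>R (Omega1 (qhat b) ** Omega2 (qhat a))"

lemma inner_measurement_matrix:
  "p \<bullet> (measurement_matrix a b *v q) =
    ((norm b)\<^sup>2 + (norm a)\<^sup>2) * (p \<bullet> q) + 2 * (p \<bullet> (qhat b \<otimes>\<^sub>q (q \<otimes>\<^sub>q qhat a)))"
proof -
  have "Omega1 (qhat b) ** Omega2 (qhat a) *v q = qhat b \<otimes>\<^sub>q (q \<otimes>\<^sub>q qhat a)"
    by (simp add: qmult_Omega2[of q] qmult_def[of "qhat b"] matrix_vector_mul_assoc)
  then show ?thesis
    by (simp add: measurement_matrix_def matrix_vector_mult_add_rdistrib
        scaleR_matrix_vector_assoc[symmetric] inner_add_right)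
qed

text \<open>Left and right multiplications commute and are skew for pure quaternions, so their
  product is symmetric. The proof checks this entrywise.\<close>

lemma transpose_measurement_matrix:
  "transpose (measurement_matrix a b) = measurement_matrix a b"
  by (simp add: measurement_matrix_def vec_eq_iff forall_4 transpose_def mat_def
      matrix_matrix_mult_def sum_4 Omega1_def Omega2_def qhat_def vector_4_nth algebra_simps)

lemma residual_eq_quadratic_form:
  assumes "q \<bullet> q = 1"
  shows "(norm (qhat b - q \<otimes>\<^sub>q qhat a \<otimes>\<^sub>q qinv q))\<^sup>2 = q \<bullet> (measurement_matrix a b *v q)"
proof -
  let ?r = "q \<otimes>\<^sub>q qhat a \<otimes>\<^sub>q qinv q"
  \<comment> \<open>Both sides are rewritten to the negative-free middle term \<open>(qhat b
    \<otimes>\<^sub>q q) \<bullet> (q \<otimes>\<^sub>q qhat a)\<close>.\<close>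
  have "qhat b \<bullet> ?r = - (q \<bullet> (qhat b \<otimes>\<^sub>q (q \<otimes>\<^sub>q qhat a)))"
    by (simp add: inner_qmult_qinv inner_qmult_qhat)
  moreover have "?r \<bullet> ?r = (norm a)\<^sup>2"
    by (simp add: inner_qmult_self inner_qinv_self inner_qhat_self assms)
  ultimately show ?thesis
    by (simp add: power2_norm_eq_inner[of "qhat b - ?r"] inner_diff_left inner_diff_right
        inner_commute[of ?r "qhat b"] inner_qhat_self inner_measurement_matrix assms)
qed

lemma Q_diag_eq: "Q_diag a b s c = (1 / (2 * s\<^sup>2)) *\<^sub>R measurement_matrix a b + (c\<^sup>2 / 2) *\<^sub>R mat 1"
  by (simp add: Q_diag_def measurement_matrix_def)

lemma Q_off_eq: "Q_off a b s c = (1 / (4 * s\<^sup>2)) *\<^sub>R measurement_matrix a b - (c\<^sup>2 / 4) *\<^sub>R mat 1"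
  by (simp add: Q_off_def measurement_matrix_def)

lemma measurement_cost_eq:
  assumes q: "q \<bullet> q = 1" and p: "p \<in> {q, - q}"
  shows "(norm (qhat b - q \<otimes>\<^sub>q qhat a \<otimes>\<^sub>q qinv q
        + (q \<bullet> p) *\<^sub>R qhat b - q \<otimes>\<^sub>q qhat a \<otimes>\<^sub>q qinv p))\<^sup>2 / (4 * s\<^sup>2) + (1 - q \<bullet> p) / 2 * c\<^sup>2
    = p \<bullet> (Q_diag a b s c *v p) + q \<bullet> (Q_off a b s c *v p) + p \<bullet> (Q_off a b s c *v q)"
proof -
  obtain t where t: "t = 1 \<or> t = -1" and pt: "p = t *\<^sub>R q"
    using p by (metis insertE scaleR_minus1_left scaleR_one singletonD)
  define m where "m = q \<bullet> (measurement_matrix a b *v q)"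
  have "qhat b - q \<otimes>\<^sub>q qhat a \<otimes>\<^sub>q qinv q + (q \<bullet> p) *\<^sub>R qhat b - q \<otimes>\<^sub>q qhat a \<otimes>\<^sub>q qinv p
      = (1 + t) *\<^sub>R (qhat b - q \<otimes>\<^sub>q qhat a \<otimes>\<^sub>q qinv q)"
    by (simp add: pt q qinv_scaleR qmult_scaleR_right algebra_simps)
  then have "(norm (qhat b - q \<otimes>\<^sub>q qhat a \<otimes>\<^sub>q qinv q
        + (q \<bullet> p) *\<^sub>R qhat b - q \<otimes>\<^sub>q qhat a \<otimes>\<^sub>q qinv p))\<^sup>2 = (1 + t)\<^sup>2 * m"
    using residual_eq_quadratic_form[OF q] by (simp add: power_mult_distrib m_def)
  moreover have "p \<bullet> (Q_diag a b s c *v p) = t\<^sup>2 * (m / (2 * s\<^sup>2) + c\<^sup>2 / 2)"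
    "q \<bullet> (Q_off a b s c *v p) = t * (m / (4 * s\<^sup>2) - c\<^sup>2 / 4)"
    "p \<bullet> (Q_off a b s c *v q) = t * (m / (4 * s\<^sup>2) - c\<^sup>2 / 4)"
    by (simp_all add: pt q m_def Q_diag_eq Q_off_eq matrix_vector_mult_add_rdistrib
        matrix_vector_mult_diff_rdistrib scaleR_matrix_vector_assoc[symmetric]
        matrix_vector_mult_scaleR inner_add_right inner_diff_right power2_eq_square algebra_simps)
  moreover have "q \<bullet> p = t"
    by (simp add: pt q)
  \<comment> \<open>This needs \<open>t\<^sup>2 = 1\<close>, which turns
    \<open>(1 + t)\<^sup>2\<close> into \<open>2 * (1 + t)\<close>.\<close>
  moreover have "(1 + t)\<^sup>2 * m / (4 * s\<^sup>2) + (1 - t) / 2 * c\<^sup>2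
      = t\<^sup>2 * (m / (2 * s\<^sup>2) + c\<^sup>2 / 2) + t * (m / (4 * s\<^sup>2) - c\<^sup>2 / 4)
        + t * (m / (4 * s\<^sup>2) - c\<^sup>2 / 4)"
    using t by auto
  ultimately show ?thesis
    by (simp only:)
qed

text \<open>Transposing a partitioned matrix swaps the block indices and transposes each block,
  hence the order \<open>l k\<close> on the left.\<close>

lemma Q_block_transpose: "transpose (Q_block a b \<sigma> c i l k) = Q_block a b \<sigma> c i k l"
proof -
  have "transpose (Q_diag a b s c) = Q_diag a b s c" "transpose (Q_off a b s c) = Q_off a b s c"
    for a b s
    using transpose_measurement_matrix[of a b]
    by (simp_all add: Q_diag_eq Q_off_eq vec_eq_iff transpose_def mat_def)
  then show ?thesis
    by (auto simp: Q_block_def transpose_def vec_eq_iff)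
qed

lemma transpose_Q_mat: "transpose (Q_mat a b \<sigma> c i) = Q_mat a b \<sigma> c i"
  using Q_block_transpose[of a b \<sigma> c i]
  by (simp add: Q_mat_def transpose_def vec_eq_iff)

lemma sum_option: "(\<Sum>k\<in>UNIV. f k) = f None + (\<Sum>i\<in>UNIV. f (Some i))"
  for f :: "'n::finite option \<Rightarrow> 'a::comm_monoid_add"
  by (simp add: UNIV_option_conv sum.reindex)

lemma inner_Q_mat_blocks:
  "x \<bullet> (Q_mat a b \<sigma> c i *v x) =
    (\<Sum>k\<in>UNIV. \<Sum>l\<in>UNIV. subvec x k \<bullet> (Q_block a b \<sigma> c i k l *v subvec x l))"
proof -
  have "x \<bullet> (Q_mat a b \<sigma> c i *v x) = (\<Sum>k\<in>UNIV. \<Sum>j\<in>UNIV. \<Sum>l\<in>UNIV. \<Sum>m\<in>UNIV.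
      x $ (k, j) * (Q_block a b \<sigma> c i k l $ j $ m * x $ (l, m)))"
    by (simp add: inner_vec_def matrix_vector_mult_def Q_mat_def sum_distrib_left
        UNIV_Times_UNIV[symmetric] sum.cartesian_product' del: UNIV_Times_UNIV)
  \<comment> \<open>Exchanging the sums over \<open>j\<close> and \<open>l\<close> gathers the
    entries of each block.\<close>
  also have "\<dots> = (\<Sum>k\<in>UNIV. \<Sum>l\<in>UNIV. \<Sum>j\<in>UNIV. \<Sum>m\<in>UNIV.
      x $ (k, j) * (Q_block a b \<sigma> c i k l $ j $ m * x $ (l, m)))"
    by (intro sum.cong refl sum.swap)
  finally show ?thesis
    by (simp add: inner_vec_def matrix_vector_mult_def subvec_def sum_distrib_left)
qed

lemma inner_Q_mat:
  fixes x :: "real^('n::finite option \<times> 4)"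
  defines "q \<equiv> subvec x None" and "p \<equiv> (\<lambda>i. subvec x (Some i))"
  shows "x \<bullet> (Q_mat a b \<sigma> c i *v x) = p i \<bullet> (Q_diag (a i) (b i) (\<sigma> i) c *v p i)
    + q \<bullet> (Q_off (a i) (b i) (\<sigma> i) c *v p i) + p i \<bullet> (Q_off (a i) (b i) (\<sigma> i) c *v q)"
proof -
  have None: "(\<Sum>l\<in>UNIV. q \<bullet> (Q_block a b \<sigma> c i None l *v subvec x l))
      = q \<bullet> (Q_off (a i) (b i) (\<sigma> i) c *v p i)"
    unfolding sum_option
    by (simp add: Q_block_def p_def if_distrib[of "\<lambda>M. q \<bullet> (M *v _)"] cong: if_cong)
  have Some: "(\<Sum>l\<in>UNIV. p k \<bullet> (Q_block a b \<sigma> c i (Some k) l *v subvec x l))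
      = (if k = i then p i \<bullet> (Q_diag (a i) (b i) (\<sigma> i) c *v p i)
          + p i \<bullet> (Q_off (a i) (b i) (\<sigma> i) c *v q) else 0)" for k
    unfolding sum_option
    by (simp add: Q_block_def p_def q_def if_distrib[of "\<lambda>M. _ \<bullet> (M *v _)"] cong: if_cong)
  show ?thesis
    unfolding inner_Q_mat_blocks sum_option[where f = "\<lambda>k. \<Sum>l\<in>UNIV. _ k l"]
    using None Some by (simp add: p_def q_def)
qed

lemma outer_nth: "outer u v $ i $ j = u $ i * v $ j"
  by (simp add: outer_def matrix_matrix_mult_def columnvector_def rowvector_def)

lemma outer_self_eq_iff:
  assumes v: "v \<bullet> v = 1"
  shows "outer u u = outer v v \<longleftrightarrow> u \<in> {v, - v}"
proof
  assume "outer u u = outer v v"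
  then have uv: "u $ i * u $ j = v $ i * v $ j" for i j
    by (metis outer_nth)
  \<comment> \<open>These are the coordinates of both outer products applied to
    \<open>v\<close>.\<close>
  have "(u \<bullet> v) * u $ i = (v \<bullet> v) * v $ i" for i
  proof -
    have "(u \<bullet> v) * u $ i = (\<Sum>j\<in>UNIV. u $ i * u $ j * v $ j)"
      by (simp add: inner_vec_def sum_distrib_left mult_ac)
    also have "\<dots> = (\<Sum>j\<in>UNIV. v $ i * v $ j * v $ j)"
      by (simp only: uv)
    also have "\<dots> = (v \<bullet> v) * v $ i"
      by (simp add: inner_vec_def sum_distrib_left mult_ac)
    finally show ?thesis .
  qed
  then have vu: "(u \<bullet> v) *\<^sub>R u = v"
    by (simp add: vec_eq_iff v)
  \<comment> \<open>Take the inner product of the previous equation with \<open>v\<close>.\<close>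
  then have "(u \<bullet> v) * (u \<bullet> v) = 1"
    using v by (metis inner_scaleR_left)
  then have "u \<bullet> v = 1 \<or> u \<bullet> v = -1"
    by (simp add: square_eq_1_iff)
  then show "u \<in> {v, - v}"
    using vu by auto
next
  assume "u \<in> {v, - v}"
  then show "outer u u = outer v v"
    by (auto simp: vec_eq_iff outer_nth)
qed

definition split_blocks :: "real^('n::finite option \<times> 4) \<Rightarrow> (real^4) \<times> ('n \<Rightarrow> real^4)" where
  "split_blocks x = (subvec x None, \<lambda>i. subvec x (Some i))"

text \<open>Ensures that every competitor in the original problem comes from some vector
  \<open>x\<close>.\<close>

lemma surj_split_blocks: "surj split_blocks"
proof (rule surjI)
  fix y :: "(real^4) \<times> ('n::finite \<Rightarrow> real^4)"
  show "split_blocks (\<chi> r. (case fst r of None \<Rightarrow> fst y | Some i \<Rightarrow> snd y i) $ snd r) = y"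
    by (simp add: split_blocks_def subvec_def)
qed

lemma orig_feasible_split_blocks: "orig_feasible (split_blocks x) \<longleftrightarrow> qcqp_feasible x"
  using outer_self_eq_iff[of "subvec x None"]
  by (auto simp: orig_feasible_def split_blocks_def qcqp_feasible_def norm_eq_1)

lemma orig_cost_split_blocks:
  assumes "qcqp_feasible x"
  shows "orig_cost a b \<sigma> c (split_blocks x) = qcqp_cost a b \<sigma> c x"
proof -
  have "orig_feasible (split_blocks x)"
    using assms by (simp add: orig_feasible_split_blocks)
  then show ?thesis
    unfolding orig_cost_def qcqp_cost_def inner_Q_mat split_blocks_def orig_feasible_def
    \<comment> \<open>The deleted simp rule would move \<open>c\<^sup>2\<close> into the numerator
      and break the match with \<open>measurement_cost_eq\<close>.\<close>
    by (auto simp: norm_eq_1 intro!: sum.cong measurement_cost_eq simp del: times_divide_eq_left)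
qed

lemma is_arg_min_split_blocks:
  "is_arg_min (orig_cost a b \<sigma> c) orig_feasible (split_blocks x)
    \<longleftrightarrow> is_arg_min (qcqp_cost a b \<sigma> c) qcqp_feasible x"
proof -
  \<comment> \<open>Both problems attain the same cost values on their feasible sets, so a threshold
    \<open>r\<close> is beaten in one exactly when it is beaten in the other.\<close>
  have "(\<exists>y. orig_feasible y \<and> orig_cost a b \<sigma> c y < r)
      \<longleftrightarrow> (\<exists>z. qcqp_feasible z \<and> qcqp_cost a b \<sigma> c z < r)" for r
    by (metis orig_feasible_split_blocks orig_cost_split_blocks surj_split_blocks surjD)
  then show ?thesis
    unfolding is_arg_min_def
    using orig_feasible_split_blocks orig_cost_split_blocks by metis
qed

theorem proposition4:
  fixes a b :: "'n::finite \<Rightarrow> real^3" and \<sigma> :: "'n \<Rightarrow> real" and c :: real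
  assumes "\<And>i. \<sigma> i > 0"
  shows "(\<forall>i. transpose (Q_mat a b \<sigma> c i) = Q_mat a b \<sigma> c i) \<and>
    (\<forall>q. (\<exists>qs. is_arg_min (orig_cost a b \<sigma> c) orig_feasible (q, qs)) \<longleftrightarrow>
         (\<exists>x. is_arg_min (qcqp_cost a b \<sigma> c) qcqp_feasible x \<and> subvec x None = q))"
proof (intro conjI allI iffI)
  show "transpose (Q_mat a b \<sigma> c i) = Q_mat a b \<sigma> c i" for i
    by (rule transpose_Q_mat)
next
  fix q
  assume "\<exists>qs. is_arg_min (orig_cost a b \<sigma> c) orig_feasible (q, qs)"
  then obtain qs where qs: "is_arg_min (orig_cost a b \<sigma> c) orig_feasible (q, qs)" ..
  obtain x where "(q, qs) = split_blocks x"
    using surjD[OF surj_split_blocks] by blast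
  then show "\<exists>x. is_arg_min (qcqp_cost a b \<sigma> c) qcqp_feasible x \<and> subvec x None = q"
    using qs is_arg_min_split_blocks by (metis split_blocks_def fst_conv)
next
  fix q
  assume "\<exists>x. is_arg_min (qcqp_cost a b \<sigma> c) qcqp_feasible x \<and> subvec x None = q"
  then show "\<exists>qs. is_arg_min (orig_cost a b \<sigma> c) orig_feasible (q, qs)"
    using is_arg_min_split_blocks by (metis split_blocks_def)
qed

end
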